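(* Assume the following. (i) For any $\theta'\in\Theta$, $\nabla_\theta\,\mathbb{E}[h(X^{\theta'},\theta)]=\mathbb{E}[\dot h(X^{\theta'},\theta)]$. (ii) The function $\theta\mapsto \mathbb{E}[\dot h(X^{\theta},\theta)]$ is continuous. (iii) There exists a diagonal matrix $\Gamma_n=\mathrm{diag}(\gamma_n^{(1)},\dots,\gamma_n^{(p)})$ with $\gamma_n^{(k)}>0$ and $\gamma_{n*}:=\max_{1\le k\le p}\gamma_n^{(k)}\downarrow 0$ as $n\to\infty$ such that, as $n\to\infty$, $$\Gamma_n^{-1}(\widehat\theta_n-\theta_0)\xrightarrow{d}Z,\qquad \gamma_{n*}^{-1}(\widehat\theta_n-\theta_0)\xrightarrow{d}Z^*$$ for $p$-dimensional random variables $Z$ and $Z^*$. (iv) There exists a constant vector $C_{\theta_0}\in\mathbb{R}^p$ such that, as $n\to\infty$, $$\gamma_{n*}^{-1}\,\mathbb{E}\left[h(X^{\theta},\theta_0)-h(X^{\theta_0},\theta_0)\right]\Big|_{\theta=\widehat\theta_n}=C_{\theta_0}^\top\gamma_{n*}^{-1}(\widehat\theta_n-\theta_0)+o_p(1).$$ Then $$\gamma_{n*}^{-1}\left[H(\widehat\theta_n)-H(\theta_0)\right]\xrightarrow{d}\left(\mathbb{E}[\dot h(X^{\theta_0},\theta_0)]+C_{\theta_0}\right)^\top Z^*,\qquad n\to\infty.$$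
   Context: $(\Omega,\mathcal F,\mathbb P)$ is a probability space, $\mathcal X$ is a metric space with norm $\|\cdot\|$, and $\Theta\subset\mathbb{R}^p$ is a parameter set. For each $\theta\in\Theta$, $X^\theta$ is an $\mathcal X$-valued random element with distribution $P_\theta$. $\theta_0\in\Theta$ is the true parameter value. $h:\mathcal X\times\Theta\to\mathbb{R}$, $\dot h(x,\theta)=\nabla_\theta h(x,\theta)$ (gradient in $\theta$), and $H(\theta)=\mathbb{E}[h(X^\theta,\theta)]=\int_{\mathcal X}h(x,\theta)\,P_\theta(dx)$ is the expected functional of interest. $\widehat\theta_n=\widehat\theta(X^{\theta_0,n})$ is an estimator of $\theta_0$ (a $\Theta$-valued random variable), computed from data $X^{\theta_0,n}$ indexed by $n\in\mathbb{N}$. $H(\widehat\theta_n)$ means the deterministic function $H$ evaluated at $\widehat\theta_n$; likewise $\mathbb{E}[\cdots]|_{\theta=\widehat\theta_n}$ means that the expectation is first computed for deterministic $\theta$ and then evaluated at $\theta=\widehat\theta_n$. $\xrightarrow{d}$ is convergence in distribution, and $o_p(1)$ denotes convergence to $0$ in probability.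
   Formalization: Since (ii) alone does not suffice, (θ',θ) ↦ E[ḣ(X^{θ'},θ)] is also assumed jointly continuous at (θ_0,θ_0); Θ is taken open so gradients make sense, the expectations are assumed to exist, and H(θ̂_n) and the remainder in (iv) are assumed measurable. *)

theory Defs
  imports "HOL-Probability.Probability"
begin

text \<open>
  The library's \<open>weak_conv_m\<close> is confined to laws on the real line (it speaks about distribution
  functions), so convergence in distribution is defined here by bounded continuous test functions;
  \<open>conv_in_distr_real_iff\<close> below shows that the two agree for real random variables.
  The limit may live on a probability space \<open>N\<close> of its own: only its law matters.
\<close>

definition conv_in_distr ::
    "'a measure \<Rightarrow> (nat \<Rightarrow> 'a \<Rightarrow> 'c::topological_space) \<Rightarrow> 'b measure \<Rightarrow> ('b \<Rightarrow> 'c) \<Rightarrow> bool" where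
  "conv_in_distr M Y N Z \<longleftrightarrow>
     (\<forall>n. Y n \<in> borel_measurable M) \<and> Z \<in> borel_measurable N \<and>
     (\<forall>f :: 'c \<Rightarrow> real. continuous_on UNIV f \<and> bounded (range f) \<longrightarrow>
        (\<lambda>n. \<integral>\<omega>. f (Y n \<omega>) \<partial>M) \<longlonglongrightarrow> (\<integral>\<omega>. f (Z \<omega>) \<partial>N))"

definition is_op1 :: "'a measure \<Rightarrow> (nat \<Rightarrow> 'a \<Rightarrow> real) \<Rightarrow> bool" where
  "is_op1 M R \<longleftrightarrow>
     (\<forall>n. R n \<in> borel_measurable M) \<and>
     (\<forall>\<epsilon>>0. (\<lambda>n. measure M {\<omega> \<in> space M. \<epsilon> < \<bar>R n \<omega>\<bar>}) \<longlonglongrightarrow> 0)"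

definition diag_matrix :: "real ^ 'p \<Rightarrow> real ^ 'p ^ 'p" where
  "diag_matrix g = (\<chi> i j. if i = j then g $ i else 0)"

text \<open>\<open>\<gamma>\<^sub>n\<^sub>*\<close>, the largest entry of \<open>\<gamma>\<^sub>n\<close>\<close>

definition max_entry :: "real ^ 'p::finite \<Rightarrow> real" where
  "max_entry g = Max (range (($) g))"

text \<open>
  \<open>mean_at M X f t s\<close> is \<open>E[f(X\<^sup>t, s)]\<close> for deterministic parameters \<open>t\<close> (of the law) and \<open>s\<close>
  (of the function). Evaluating it at a random \<open>t = T \<omega>\<close> is then \<open>mean_at M X f (T \<omega>) s\<close>: the
  expectation is taken first, over a separate sample point.
\<close>

definition mean_at ::
    "'a measure \<Rightarrow> ('t \<Rightarrow> 'a \<Rightarrow> 'x) \<Rightarrow> ('x \<Rightarrow> 't \<Rightarrow> 'v) \<Rightarrow> 't \<Rightarrow> 't \<Rightarrow> 'v::{banach, second_countable_topology}" where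
  "mean_at M X f t s = (\<integral>\<omega>. f (X t \<omega>) s \<partial>M)"

definition expected_functional ::
    "'a measure \<Rightarrow> ('t \<Rightarrow> 'a \<Rightarrow> 'x) \<Rightarrow> ('x \<Rightarrow> 't \<Rightarrow> real) \<Rightarrow> 't \<Rightarrow> real" where
  "expected_functional M X h \<theta> = mean_at M X h \<theta> \<theta>"

lemma mean_at_distr:
  assumes "X t \<in> borel_measurable M" and "(\<lambda>x. f x s) \<in> borel_measurable borel"
  shows "mean_at M X f t s = (\<integral>x. f x s \<partial>distr M borel (X t))"
  unfolding mean_at_def using assms by (subst integral_distr) auto

lemma conv_in_distr_real_iff:
  fixes Y :: "nat \<Rightarrow> 'a \<Rightarrow> real" and Z :: "'b \<Rightarrow> real"
  assumes "prob_space M" "prob_space N"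
    and Y: "\<And>n. Y n \<in> borel_measurable M" and Z: "Z \<in> borel_measurable N"
  shows "conv_in_distr M Y N Z \<longleftrightarrow> weak_conv_m (\<lambda>n. distr M borel (Y n)) (distr N borel Z)"
proof -
  interpret M: prob_space M by fact
  interpret N: prob_space N by fact
  have rd: "real_distribution (distr M borel (Y n))" for n
    using Y by (intro M.real_distribution_distr)
  have rd': "real_distribution (distr N borel Z)"
    using Z by (intro N.real_distribution_distr)
  have E: "(\<integral>x. f x \<partial>distr M borel (Y n)) = (\<integral>\<omega>. f (Y n \<omega>) \<partial>M)"
    and E': "(\<integral>x. f x \<partial>distr N borel Z) = (\<integral>\<omega>. f (Z \<omega>) \<partial>N)"
    if "continuous_on UNIV f" for f :: "real \<Rightarrow> real" and n
    using that Y Z by (auto intro!: integral_distr borel_measurable_continuous_onI)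
  show ?thesis
  proof
    assume L: "conv_in_distr M Y N Z"
    show "weak_conv_m (\<lambda>n. distr M borel (Y n)) (distr N borel Z)"
    proof (rule integral_bdd_continuous_conv_imp_weak_conv[OF rd rd'])
      fix f :: "real \<Rightarrow> real"
      assume f: "\<And>x. isCont f x" "\<And>x. \<bar>f x\<bar> \<le> 1"
      have c: "continuous_on UNIV f"
        using f(1) by (simp add: continuous_at_imp_continuous_on)
      have "bounded (range f)"
        using f(2) by (auto intro!: boundedI[where B = 1])
      with L c show "(\<lambda>n. integral\<^sup>L (distr M borel (Y n)) f) \<longlonglongrightarrow> integral\<^sup>L (distr N borel Z) f"
        unfolding conv_in_distr_def by (simp add: E[OF c] E'[OF c])
    qed
  next
    assume R: "weak_conv_m (\<lambda>n. distr M borel (Y n)) (distr N borel Z)"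
    show "conv_in_distr M Y N Z"
      unfolding conv_in_distr_def
    proof (intro conjI allI impI Y Z)
      fix f :: "real \<Rightarrow> real"
      assume f: "continuous_on UNIV f \<and> bounded (range f)"
      then obtain B where B: "\<And>x. norm (f x) \<le> B"
        by (auto simp: bounded_iff)
      have "isCont f x" for x
        using f by (simp add: continuous_on_eq_continuous_at)
      from weak_conv_imp_integral_bdd_continuous_conv[OF rd rd' R this B]
      show "(\<lambda>n. \<integral>\<omega>. f (Y n \<omega>) \<partial>M) \<longlonglongrightarrow> (\<integral>\<omega>. f (Z \<omega>) \<partial>N)"
        using f by (simp add: E E')
    qed
  qed
qed

end

theory Submission
  imports Defs
begin

text \<open>
  Write \<open>m(t, s) = E[h(X\<^sup>t, s)]\<close> and split \<open>H(\<theta>) - H(\<theta>0)\<close> into \<open>m(\<theta>, \<theta>) - m(\<theta>, \<theta>0)\<close> and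
  \<open>m(\<theta>, \<theta>0) - m(\<theta>0, \<theta>0)\<close>. Assumption (iv) linearises the second part. The mean value theorem in
  the second argument, with the joint continuity of the gradient at \<open>(\<theta>0, \<theta>0)\<close>, shows that the first
  part differs from \<open>E[hdot(X\<^sup>\<theta>\<^sup>0, \<theta>0)] \<bullet> (\<theta> - \<theta>0)\<close> by \<open>o(|\<theta> - \<theta>0|)\<close>. Since the rescaled estimation
  error converges in distribution, it is tight, so that this difference is \<open>o\<^sub>p(1)\<close> after rescaling,
  and Slutsky's lemma with the continuous mapping theorem gives the limit.
\<close>

section \<open>Convergence in distribution: continuous images and tightness\<close>

lemma conv_in_distr_continuous_map:
  fixes g :: "'c::topological_space \<Rightarrow> 'd::topological_space"
  assumes YZ: "conv_in_distr M Y N Z" and g: "continuous_on UNIV g"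
  shows "conv_in_distr M (\<lambda>n \<omega>. g (Y n \<omega>)) N (\<lambda>\<omega>. g (Z \<omega>))"
  unfolding conv_in_distr_def
proof (intro conjI allI impI)
  show "(\<lambda>\<omega>. g (Y n \<omega>)) \<in> borel_measurable M" for n
    using YZ g by (auto simp: conv_in_distr_def intro: borel_measurable_continuous_on)
  show "(\<lambda>\<omega>. g (Z \<omega>)) \<in> borel_measurable N"
    using YZ g by (auto simp: conv_in_distr_def intro: borel_measurable_continuous_on)
  fix f :: "'d \<Rightarrow> real" assume f: "continuous_on UNIV f \<and> bounded (range f)"
  have "continuous_on UNIV (\<lambda>x. f (g x))"
    using f g continuous_on_compose2[of UNIV f UNIV g] by auto
  moreover have "bounded (range (\<lambda>x. f (g x)))"
    using f by (auto intro: bounded_subset)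
  ultimately show "(\<lambda>n. \<integral>\<omega>. f (g (Y n \<omega>)) \<partial>M) \<longlonglongrightarrow> (\<integral>\<omega>. f (g (Z \<omega>)) \<partial>N)"
    using YZ unfolding conv_in_distr_def by (elim conjE allE[of _ "\<lambda>x. f (g x)"]) auto
qed

text \<open>The indicator of a large norm is not a continuous test function, but a continuous ramp
  lies above it. The ramp has small expectation under the limit once it starts far enough out, and
  convergence in distribution carries this over to \<open>Y n\<close> for all large
  \<open>n\<close>.\<close>

lemma conv_in_distr_tight:
  fixes Y :: "nat \<Rightarrow> 'a \<Rightarrow> 'c::real_normed_vector"
  assumes "prob_space M" "prob_space N" and YZ: "conv_in_distr M Y N Z" and "0 < \<eta>"
  obtains K where "0 < K"
    and "\<forall>\<^sub>F n in sequentially. measure M {\<omega> \<in> space M. K < norm (Y n \<omega>)} < \<eta>"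
proof -
  interpret M: prob_space M by fact
  interpret N: prob_space N by fact
  \<comment> \<open>The ramp is 0 up to norm \<open>k\<close> and 1 from norm \<open>k + 1\<close>
    on.\<close>
  define f where "f k y = min 1 (max 0 (norm y - real k))" for k :: nat and y :: 'c
  have f01: "0 \<le> f k y" "f k y \<le> 1" for k y by (auto simp: f_def)
  have fc: "continuous_on UNIV (f k)" for k
    unfolding f_def by (intro continuous_intros)
  have Z: "Z \<in> borel_measurable N" and Y: "\<And>n. Y n \<in> borel_measurable M"
    using YZ by (auto simp: conv_in_distr_def)
  have nY[measurable]: "(\<lambda>\<omega>. norm (Y n \<omega>)) \<in> borel_measurable M" for n
    by (rule borel_measurable_continuous_on[OF _ Y]) (intro continuous_intros)
  have fY[measurable]: "(\<lambda>\<omega>. f k (Y n \<omega>)) \<in> borel_measurable M" for n k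
    by (rule borel_measurable_continuous_on[OF fc Y])
  have fZ[measurable]: "(\<lambda>\<omega>. f k (Z \<omega>)) \<in> borel_measurable N" for k
    by (rule borel_measurable_continuous_on[OF fc Z])
  \<comment> \<open>At each fixed point the ramp vanishes as soon as \<open>k\<close> exceeds the
    norm, so the constant 1 serves as dominating function on the probability space
    \<open>N\<close>.\<close>
  have "(\<lambda>k. \<integral>\<omega>. f k (Z \<omega>) \<partial>N) \<longlonglongrightarrow> (\<integral>\<omega>. 0 \<partial>N)"
  proof (rule integral_dominated_convergence[where w = "\<lambda>_. 1"])
    have "(\<lambda>k. f k z) \<longlonglongrightarrow> 0" for z
    proof (rule tendsto_eventually)
      show "\<forall>\<^sub>F k in sequentially. f k z = 0"
        using eventually_ge_at_top[of "nat \<lceil>norm z\<rceil>"]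
        by eventually_elim (auto simp: f_def max_def min_def; linarith)
    qed
    then show "AE \<omega> in N. (\<lambda>k. f k (Z \<omega>)) \<longlonglongrightarrow> 0" by simp
  qed (use f01 in auto)
  then have "\<forall>\<^sub>F k in sequentially. (\<integral>\<omega>. f k (Z \<omega>) \<partial>N) < \<eta>"
    using \<open>0 < \<eta>\<close> by (simp add: order_tendsto_iff)
  then obtain k where k: "(\<integral>\<omega>. f k (Z \<omega>) \<partial>N) < \<eta>"
    by (auto simp: eventually_sequentially)
  have "bounded (range (f k))"
    using f01 by (auto intro!: boundedI[where B = 1] simp: abs_le_iff intro: order_trans[of _ 0])
  with YZ fc have "(\<lambda>n. \<integral>\<omega>. f k (Y n \<omega>) \<partial>M) \<longlonglongrightarrow> (\<integral>\<omega>. f k (Z \<omega>) \<partial>N)"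
    by (simp add: conv_in_distr_def)
  then have "\<forall>\<^sub>F n in sequentially. (\<integral>\<omega>. f k (Y n \<omega>) \<partial>M) < \<eta>"
    using k by (rule order_tendstoD(2))
  \<comment> \<open>The extra 1 is the width of the ramp: beyond \<open>k + 1\<close> the ramp
    equals 1 and so dominates the indicator.\<close>
  then have "\<forall>\<^sub>F n in sequentially. measure M {\<omega> \<in> space M. real k + 1 < norm (Y n \<omega>)} < \<eta>"
  proof eventually_elim
    case (elim n)
    have "measure M {\<omega> \<in> space M. real k + 1 < norm (Y n \<omega>)}
        = (\<integral>\<omega>. indicator {\<omega> \<in> space M. real k + 1 < norm (Y n \<omega>)} \<omega> \<partial>M)"
      by simp
    also have "\<dots> \<le> (\<integral>\<omega>. f k (Y n \<omega>) \<partial>M)"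
    proof (rule integral_mono)
      show "integrable M (\<lambda>\<omega>. f k (Y n \<omega>))"
        using f01 by (intro M.integrable_const_bound[where B = 1]) auto
      show "indicator {\<omega> \<in> space M. real k + 1 < norm (Y n \<omega>)} \<omega> \<le> f k (Y n \<omega>)"
        if "\<omega> \<in> space M" for \<omega>
        using that by (auto simp: f_def split: split_indicator)
    qed (auto simp: M.emeasure_eq_measure)
    finally show ?case using elim by linarith
  qed
  with that[of "real k + 1"] show thesis by auto
qed

section \<open>Remainders that vanish in probability\<close>

lemma is_op1I:
  assumes "\<And>n. R n \<in> borel_measurable M"
    and "\<And>\<epsilon> \<eta>. 0 < \<epsilon> \<Longrightarrow> 0 < \<eta> \<Longrightarrow>
      \<forall>\<^sub>F n in sequentially. measure M {\<omega> \<in> space M. \<epsilon> < \<bar>R n \<omega>\<bar>} < \<eta>"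
  shows "is_op1 M R"
  using assms by (auto simp: is_op1_def tendsto_iff)

lemma is_op1_eventually:
  assumes "is_op1 M R" "0 < \<epsilon>" "0 < \<eta>"
  shows "\<forall>\<^sub>F n in sequentially. measure M {\<omega> \<in> space M. \<epsilon> < \<bar>R n \<omega>\<bar>} < \<eta>"
  using assms by (intro order_tendstoD(2)[of _ 0]) (auto simp: is_op1_def)

text \<open>A sum exceeds \<epsilon> only if one summand exceeds half of it, so a union bound
  suffices.\<close>

lemma is_op1_add:
  assumes "prob_space M" and R: "is_op1 M R" and S: "is_op1 M S"
  shows "is_op1 M (\<lambda>n \<omega>. R n \<omega> + S n \<omega>)"
proof (rule is_op1I)
  interpret prob_space M by fact
  have [measurable]: "R n \<in> borel_measurable M" "S n \<in> borel_measurable M" for n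
    using R S by (auto simp: is_op1_def)
  show "(\<lambda>\<omega>. R n \<omega> + S n \<omega>) \<in> borel_measurable M" for n by measurable
  fix \<epsilon> \<eta> :: real assume pos: "0 < \<epsilon>" "0 < \<eta>"
  from is_op1_eventually[OF R, of "\<epsilon>/2" "\<eta>/2"] is_op1_eventually[OF S, of "\<epsilon>/2" "\<eta>/2"] pos
  have "\<forall>\<^sub>F n in sequentially. prob {\<omega> \<in> space M. \<epsilon>/2 < \<bar>R n \<omega>\<bar>} < \<eta>/2"
    "\<forall>\<^sub>F n in sequentially. prob {\<omega> \<in> space M. \<epsilon>/2 < \<bar>S n \<omega>\<bar>} < \<eta>/2"
    by auto
  then show "\<forall>\<^sub>F n in sequentially. prob {\<omega> \<in> space M. \<epsilon> < \<bar>R n \<omega> + S n \<omega>\<bar>} < \<eta>"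
  proof eventually_elim
    case (elim n)
    have "prob {\<omega> \<in> space M. \<epsilon> < \<bar>R n \<omega> + S n \<omega>\<bar>}
        \<le> prob ({\<omega> \<in> space M. \<epsilon>/2 < \<bar>R n \<omega>\<bar>} \<union> {\<omega> \<in> space M. \<epsilon>/2 < \<bar>S n \<omega>\<bar>})"
      by (intro finite_measure_mono) auto
    also have "\<dots> \<le> prob {\<omega> \<in> space M. \<epsilon>/2 < \<bar>R n \<omega>\<bar>} + prob {\<omega> \<in> space M. \<epsilon>/2 < \<bar>S n \<omega>\<bar>}"
      by (intro measure_Un_le) auto
    finally show ?case using elim by linarith
  qed
qed

section \<open>Stability of limit laws and tightness of rescaled errors\<close>

text \<open>A test function is merely continuous and bounded, but it is uniformly continuous on
  closed balls, which are compact here. Tightness keeps \<open>V n\<close> in such a ball up to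
  small probability; where \<open>W n\<close> is also close to \<open>V n\<close>, the two test
  values nearly agree, and elsewhere boundedness is enough.\<close>

lemma slutsky_add:
  fixes V W :: "nat \<Rightarrow> 'a \<Rightarrow> 'c::euclidean_space"
  assumes "prob_space M" "prob_space N" and VZ: "conv_in_distr M V N Z"
    and W[measurable]: "\<And>n. W n \<in> borel_measurable M"
    and WV: "is_op1 M (\<lambda>n \<omega>. norm (W n \<omega> - V n \<omega>))"
  shows "conv_in_distr M W N Z"
  unfolding conv_in_distr_def
proof (intro conjI allI impI W)
  interpret M: prob_space M by fact
  have [measurable]: "V n \<in> borel_measurable M" for n
    using VZ by (auto simp: conv_in_distr_def)
  show "Z \<in> borel_measurable N"
    using VZ by (auto simp: conv_in_distr_def)
  fix f :: "'c \<Rightarrow> real" assume f: "continuous_on UNIV f \<and> bounded (range f)"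
  then obtain B where B: "0 < B" "\<And>x. \<bar>f x\<bar> \<le> B"
    by (auto simp: bounded_pos)
  have [measurable]: "f \<in> borel_measurable borel"
    using f by (auto intro: borel_measurable_continuous_onI)
  have int[simp]: "integrable M (\<lambda>\<omega>. f (V n \<omega>))" "integrable M (\<lambda>\<omega>. f (W n \<omega>))" for n
    using B by (auto intro!: M.integrable_const_bound[where B = B])
  have fV: "(\<lambda>n. \<integral>\<omega>. f (V n \<omega>) \<partial>M) \<longlonglongrightarrow> (\<integral>\<omega>. f (Z \<omega>) \<partial>N)"
    using VZ f by (simp add: conv_in_distr_def)
  have "(\<lambda>n. (\<integral>\<omega>. f (W n \<omega>) \<partial>M) - (\<integral>\<omega>. f (V n \<omega>) \<partial>M)) \<longlonglongrightarrow> 0"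
    unfolding tendsto_iff
  proof (intro allI impI)
    fix e :: real assume "0 < e"
    \<comment> \<open>Two exceptional events of probability below \<eta> each cost at most
      \<open>2 * B\<close> per unit of probability, hence \<open>4 * B * \<eta> = e / 2\<close>
      together. Uniform continuity supplies the other \<open>e / 2\<close>.\<close>
    define \<eta> where "\<eta> = e / (8 * B)"
    have "0 < \<eta>" using \<open>0 < e\<close> \<open>0 < B\<close> by (simp add: \<eta>_def)
    obtain K where K: "0 < K"
      "\<forall>\<^sub>F n in sequentially. M.prob {\<omega> \<in> space M. K < norm (V n \<omega>)} < \<eta>"
      using conv_in_distr_tight[OF assms(1,2) VZ \<open>0 < \<eta>\<close>] by blast
    \<comment> \<open>The margin 1 leaves room for \<open>W n\<close>, which may lie slightly
      outside the ball of radius \<open>K\<close> that contains \<open>V n\<close>.\<close>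
    have "uniformly_continuous_on (cball 0 (K + 1)) f"
      using f by (intro compact_uniformly_continuous) (auto intro: continuous_on_subset)
    then obtain d where d: "0 < d"
      "\<And>x y. x \<in> cball 0 (K + 1) \<Longrightarrow> y \<in> cball 0 (K + 1) \<Longrightarrow> dist y x < d \<Longrightarrow> dist (f y) (f x) < e / 2"
      unfolding uniformly_continuous_on_def using \<open>0 < e\<close> by (meson half_gt_zero)
    \<comment> \<open>The bound 1 keeps \<open>W n\<close> within the margin; \<open>d / 2\<close>
      turns the weak inequality off the exceptional event into the strict one required by
      \<open>d\<close>.\<close>
    define r where "r = min 1 (d / 2)"
    have "0 < r" using d by (simp add: r_def)
    from K(2) is_op1_eventually[OF WV \<open>0 < r\<close> \<open>0 < \<eta>\<close>]
    show "\<forall>\<^sub>F n in sequentially.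
        dist ((\<integral>\<omega>. f (W n \<omega>) \<partial>M) - (\<integral>\<omega>. f (V n \<omega>) \<partial>M)) 0 < e"
    proof eventually_elim
      case (elim n)
      let ?A = "{\<omega> \<in> space M. K < norm (V n \<omega>)}"
      let ?D = "{\<omega> \<in> space M. r < \<bar>norm (W n \<omega> - V n \<omega>)\<bar>}"
      \<comment> \<open>Adding the two indicators, instead of taking that of the union, builds the
        union bound into the integrand.\<close>
      have bound: "\<bar>f (W n \<omega>) - f (V n \<omega>)\<bar> \<le> e / 2 + 2 * B * (indicator ?A \<omega> + indicator ?D \<omega>)"
        if "\<omega> \<in> space M" for \<omega>
      proof (cases "\<omega> \<in> ?A \<or> \<omega> \<in> ?D")
        case True
        have "\<bar>f (W n \<omega>) - f (V n \<omega>)\<bar> \<le> 2 * B"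
          using B(2)[of "W n \<omega>"] B(2)[of "V n \<omega>"] by linarith
        also have "\<dots> \<le> 2 * B * (indicator ?A \<omega> + indicator ?D \<omega>)"
          using True B(1) by (auto simp: indicator_def)
        finally show ?thesis using \<open>0 < e\<close> by linarith
      next
        case False
        then have *: "norm (V n \<omega>) \<le> K" "norm (W n \<omega> - V n \<omega>) \<le> r"
          using that by auto
        moreover have "norm (W n \<omega>) \<le> norm (V n \<omega>) + norm (W n \<omega> - V n \<omega>)"
          by (metis add.commute diff_add_cancel norm_triangle_ineq)
        ultimately have "dist (f (W n \<omega>)) (f (V n \<omega>)) < e / 2"
          using d(1) by (intro d(2)) (auto simp: dist_norm r_def)
        then show ?thesis
          using B(1) False by (auto simp: dist_real_def)
      qed
      have int': "integrable M (\<lambda>\<omega>. e / 2 + 2 * B * (indicator ?A \<omega> + indicator ?D \<omega>))"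
        by (intro Bochner_Integration.integrable_add integrable_mult_right integrable_real_indicator)
          (auto simp: M.emeasure_eq_measure)
      have "\<bar>(\<integral>\<omega>. f (W n \<omega>) \<partial>M) - (\<integral>\<omega>. f (V n \<omega>) \<partial>M)\<bar> = \<bar>\<integral>\<omega>. f (W n \<omega>) - f (V n \<omega>) \<partial>M\<bar>"
        by simp
      also have "\<dots> \<le> (\<integral>\<omega>. \<bar>f (W n \<omega>) - f (V n \<omega>)\<bar> \<partial>M)"
        by (rule integral_abs_bound)
      also have "\<dots> \<le> (\<integral>\<omega>. e / 2 + 2 * B * (indicator ?A \<omega> + indicator ?D \<omega>) \<partial>M)"
        using bound int' by (intro integral_mono) auto
      also have "\<dots> = e / 2 + 2 * B * (M.prob ?A + M.prob ?D)"
        by (subst Bochner_Integration.integral_add)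
          (auto simp: M.emeasure_eq_measure M.prob_space)
      also have "\<dots> < e / 2 + 2 * B * (\<eta> + \<eta>)"
        using elim B(1) by (intro add_strict_left_mono mult_strict_left_mono) auto
      also have "\<dots> = e" using B(1) by (simp add: \<eta>_def)
      finally show ?case by simp
    qed
  qed
  from tendsto_add[OF this fV] show "(\<lambda>n. \<integral>\<omega>. f (W n \<omega>) \<partial>M) \<longlonglongrightarrow> (\<integral>\<omega>. f (Z \<omega>) \<partial>N)"
    by simp
qed

text \<open>Where \<open>norm (U n \<omega>)\<close> is at most \<open>K\<close>, the increment
  \<open>c n *\<^sub>R U n \<omega>\<close> is eventually shorter than any \<delta>, so the little-o
  bound applies; tightness makes the remaining event improbable. The uniformity of \<delta> in
  \<open>n\<close> and \<omega> is what lets a deterministic expansion be evaluated at a random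
  point.\<close>

lemma is_op1_little_o_tight:
  fixes U :: "nat \<Rightarrow> 'a \<Rightarrow> 'c::{real_normed_vector, second_countable_topology}"
  assumes "prob_space M" "prob_space N" and UZ: "conv_in_distr M U N Z"
    and R: "\<And>n. R n \<in> borel_measurable M" and c: "c \<longlonglongrightarrow> 0"
    and small: "\<And>\<epsilon>. 0 < \<epsilon> \<Longrightarrow> \<exists>\<delta>>0. \<forall>n. \<forall>\<omega>\<in>space M.
      norm (c n *\<^sub>R U n \<omega>) < \<delta> \<longrightarrow> \<bar>R n \<omega>\<bar> \<le> \<epsilon> * norm (U n \<omega>)"
  shows "is_op1 M R"
proof (rule is_op1I[OF R])
  interpret prob_space M by fact
  have [measurable]: "U n \<in> borel_measurable M" for n
    using UZ by (auto simp: conv_in_distr_def)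
  fix \<epsilon> \<eta> :: real assume "0 < \<epsilon>" "0 < \<eta>"
  obtain K where K: "0 < K"
    "\<forall>\<^sub>F n in sequentially. prob {\<omega> \<in> space M. K < norm (U n \<omega>)} < \<eta>"
    using conv_in_distr_tight[OF assms(1,2) UZ \<open>0 < \<eta>\<close>] by blast
  \<comment> \<open>The factor \<open>\<epsilon> / K\<close> becomes \<epsilon> after multiplication
    by a norm of at most \<open>K\<close>.\<close>
  obtain \<delta> where \<delta>: "0 < \<delta>" "\<And>n \<omega>. \<omega> \<in> space M \<Longrightarrow> norm (c n *\<^sub>R U n \<omega>) < \<delta> \<Longrightarrow>
      \<bar>R n \<omega>\<bar> \<le> \<epsilon> / K * norm (U n \<omega>)"
    using small[of "\<epsilon> / K"] \<open>0 < \<epsilon>\<close> \<open>0 < K\<close> by auto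
  have "\<forall>\<^sub>F n in sequentially. \<bar>c n\<bar> < \<delta> / K"
    using c \<delta>(1) K(1) by (auto simp: tendsto_iff)
  with K(2) show "\<forall>\<^sub>F n in sequentially. prob {\<omega> \<in> space M. \<epsilon> < \<bar>R n \<omega>\<bar>} < \<eta>"
  proof eventually_elim
    case (elim n)
    have "\<bar>R n \<omega>\<bar> \<le> \<epsilon>" if "\<omega> \<in> space M" "norm (U n \<omega>) \<le> K" for \<omega>
    proof -
      have "norm (c n *\<^sub>R U n \<omega>) \<le> \<bar>c n\<bar> * K"
        using that by (simp add: mult_left_mono)
      also have "\<dots> < \<delta>" using elim K(1) by (simp add: field_simps)
      finally have "\<bar>R n \<omega>\<bar> \<le> \<epsilon> / K * norm (U n \<omega>)" using that \<delta>(2) by blast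
      also have "\<dots> \<le> \<epsilon> / K * K"
        using that \<open>0 < \<epsilon>\<close> K(1) by (intro mult_left_mono) auto
      finally show ?thesis using K(1) by simp
    qed
    then have "prob {\<omega> \<in> space M. \<epsilon> < \<bar>R n \<omega>\<bar>} \<le> prob {\<omega> \<in> space M. K < norm (U n \<omega>)}"
      by (intro finite_measure_mono) (auto simp: not_le[symmetric])
    with elim show ?case by linarith
  qed
qed

section \<open>Deterministic first-order expansion in the second argument\<close>

text \<open>The first argument moves together with the endpoint \<open>t\<close>, so a derivative at
  one fixed first argument does not suffice. The mean value inequality is applied to
  \<open>m t\<close> for each \<open>t\<close> separately; joint continuity of \<open>m'\<close> at
  \<open>(a, a)\<close> keeps all gradients met on the way within \<epsilon> of
  \<open>m' a a\<close>.\<close>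

lemma joint_gradient_expansion:
  fixes m :: "'v::euclidean_space \<Rightarrow> 'v \<Rightarrow> real" and m' :: "'v \<Rightarrow> 'v \<Rightarrow> 'v"
  assumes "open S" "a \<in> S"
    and deriv: "\<And>t s. t \<in> S \<Longrightarrow> s \<in> S \<Longrightarrow> GDERIV (m t) s :> m' t s"
    and cont: "isCont (\<lambda>(t, s). m' t s) (a, a)" and "0 < \<epsilon>"
  shows "\<exists>\<delta>>0. \<forall>t. norm (t - a) < \<delta> \<longrightarrow>
    \<bar>m t t - m t a - m' a a \<bullet> (t - a)\<bar> \<le> \<epsilon> * norm (t - a)"
proof -
  obtain d where d: "0 < d" "\<And>p. dist p (a, a) < d \<Longrightarrow> dist ((\<lambda>(t, s). m' t s) p) (m' a a) < \<epsilon>"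
    using cont \<open>0 < \<epsilon>\<close> by (force simp: continuous_at_eps_delta)
  obtain r where r: "0 < r" "ball a r \<subseteq> S"
    using \<open>open S\<close> \<open>a \<in> S\<close> openE by blast
  \<comment> \<open>\<open>r\<close> keeps both arguments in \<open>S\<close>; each coordinate may
    use half of \<open>d\<close>, because the distance of pairs is at most the sum of the coordinate
    distances.\<close>
  define \<delta> where "\<delta> = min r (d / 2)"
  have "0 < \<delta>" using d r by (simp add: \<delta>_def)
  moreover have "\<bar>m t t - m t a - m' a a \<bullet> (t - a)\<bar> \<le> \<epsilon> * norm (t - a)"
    if "norm (t - a) < \<delta>" for t
  proof -
    have t: "t \<in> ball a \<delta>" using that by (simp add: dist_norm norm_minus_commute)
    \<comment> \<open>With the linear part subtracted, the increment of \<open>?g\<close> from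
      \<open>a\<close> to \<open>t\<close> is exactly the expansion error.\<close>
    let ?g = "\<lambda>s. m t s - m' a a \<bullet> s"
    have "norm (?g t - ?g a) \<le> \<epsilon> * norm (t - a)"
    proof (rule differentiable_bound[where S = "ball a \<delta>" and f' = "\<lambda>s v. v \<bullet> m' t s - m' a a \<bullet> v"])
      fix s assume s: "s \<in> ball a \<delta>"
      have "t \<in> S" "s \<in> S" using t s r by (auto simp: \<delta>_def)
      then have "(m t has_derivative (\<lambda>v. v \<bullet> m' t s)) (at s within ball a \<delta>)"
        using deriv by (auto simp: gderiv_def intro: has_derivative_at_withinI)
      then show "(?g has_derivative (\<lambda>v. v \<bullet> m' t s - m' a a \<bullet> v)) (at s within ball a \<delta>)"
        by (auto intro!: derivative_eq_intros)
      have "dist (t, s) (a, a) \<le> dist t a + dist s a"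
        by (simp add: dist_Pair_Pair sqrt_sum_squares_le_sum)
      also have "\<dots> < d" using t s by (auto simp: \<delta>_def dist_commute)
      finally have "norm (m' t s - m' a a) < \<epsilon>"
        using d(2)[of "(t, s)"] by (simp add: dist_norm)
      moreover have "norm (v \<bullet> m' t s - m' a a \<bullet> v) \<le> norm (m' t s - m' a a) * norm v" for v
        using Cauchy_Schwarz_ineq2[of "m' t s - m' a a" v]
        by (simp add: inner_diff_left inner_diff_right inner_commute)
      ultimately show "onorm (\<lambda>v. v \<bullet> m' t s - m' a a \<bullet> v) \<le> \<epsilon>"
        by (intro onorm_le) (meson less_imp_le mult_right_mono norm_ge_zero order_trans)
    qed (use t \<open>0 < \<delta>\<close> in auto)
    then show ?thesis by (simp add: inner_diff_right algebra_simps)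
  qed
  ultimately show ?thesis by blast
qed

section \<open>Limit law of the functional at the estimator\<close>

theorem theorem2p1:
  fixes M :: "'a measure" and N :: "'b measure"
    and \<Theta> :: "(real ^ 'p::finite) set" and \<theta>0 :: "real ^ 'p"
    and X :: "real ^ 'p \<Rightarrow> 'a \<Rightarrow> 'x::metric_space"
    and h :: "'x \<Rightarrow> real ^ 'p \<Rightarrow> real" and hdot :: "'x \<Rightarrow> real ^ 'p \<Rightarrow> real ^ 'p"
    and \<theta>hat :: "nat \<Rightarrow> 'a \<Rightarrow> real ^ 'p"
    and \<gamma> :: "nat \<Rightarrow> real ^ 'p"
    and Z Zstar :: "'b \<Rightarrow> real ^ 'p" and C :: "real ^ 'p"
  assumes "prob_space M" and "prob_space N"
    and "open \<Theta>" and "\<theta>0 \<in> \<Theta>"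
    and "\<And>\<theta>. \<theta> \<in> \<Theta> \<Longrightarrow> X \<theta> \<in> borel_measurable M"
    and "\<And>x \<theta>. \<theta> \<in> \<Theta> \<Longrightarrow> GDERIV (h x) \<theta> :> hdot x \<theta>"
    and "\<And>\<theta>' \<theta>. \<theta>' \<in> \<Theta> \<Longrightarrow> \<theta> \<in> \<Theta> \<Longrightarrow> integrable M (\<lambda>\<omega>. h (X \<theta>' \<omega>) \<theta>)"
    and "\<And>\<theta>' \<theta>. \<theta>' \<in> \<Theta> \<Longrightarrow> \<theta> \<in> \<Theta> \<Longrightarrow> integrable M (\<lambda>\<omega>. hdot (X \<theta>' \<omega>) \<theta>)"
    and "\<And>n. \<theta>hat n \<in> borel_measurable M"
    and "\<And>n \<omega>. \<omega> \<in> space M \<Longrightarrow> \<theta>hat n \<omega> \<in> \<Theta>"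
    and "\<And>n. (\<lambda>\<omega>. expected_functional M X h (\<theta>hat n \<omega>)) \<in> borel_measurable M"
    and i: "\<And>\<theta>' \<theta>. \<theta>' \<in> \<Theta> \<Longrightarrow> \<theta> \<in> \<Theta> \<Longrightarrow>
           GDERIV (\<lambda>\<theta>. mean_at M X h \<theta>' \<theta>) \<theta> :> mean_at M X hdot \<theta>' \<theta>"
    and ii: "continuous_on \<Theta> (\<lambda>\<theta>. mean_at M X hdot \<theta> \<theta>)"
    and ii_joint: "isCont (\<lambda>(\<theta>', \<theta>). mean_at M X hdot \<theta>' \<theta>) (\<theta>0, \<theta>0)"
    and iii_pos: "\<And>n k. \<gamma> n $ k > 0"
    and iii_dec: "decseq (\<lambda>n. max_entry (\<gamma> n))"
    and iii_lim: "(\<lambda>n. max_entry (\<gamma> n)) \<longlonglongrightarrow> 0"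
    and iii_Z: "conv_in_distr M (\<lambda>n \<omega>. matrix_inv (diag_matrix (\<gamma> n)) *v (\<theta>hat n \<omega> - \<theta>0)) N Z"
    and iii_Zstar: "conv_in_distr M (\<lambda>n \<omega>. inverse (max_entry (\<gamma> n)) *\<^sub>R (\<theta>hat n \<omega> - \<theta>0)) N Zstar"
    and iv: "is_op1 M (\<lambda>n \<omega>.
           inverse (max_entry (\<gamma> n)) *
             ((\<lambda>\<theta>. \<integral>\<omega>'. h (X \<theta> \<omega>') \<theta>0 - h (X \<theta>0 \<omega>') \<theta>0 \<partial>M) (\<theta>hat n \<omega>))
           - C \<bullet> (inverse (max_entry (\<gamma> n)) *\<^sub>R (\<theta>hat n \<omega> - \<theta>0)))"
  shows "conv_in_distr M
           (\<lambda>n \<omega>. inverse (max_entry (\<gamma> n)) *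
              (expected_functional M X h (\<theta>hat n \<omega>) - expected_functional M X h \<theta>0))
           N (\<lambda>\<omega>. (mean_at M X hdot \<theta>0 \<theta>0 + C) \<bullet> Zstar \<omega>)"
proof -
  define c where "c n = max_entry (\<gamma> n)" for n
  define U where "U n \<omega> = inverse (c n) *\<^sub>R (\<theta>hat n \<omega> - \<theta>0)" for n \<omega>
  define W where "W n \<omega> = inverse (c n) *
      (expected_functional M X h (\<theta>hat n \<omega>) - expected_functional M X h \<theta>0)" for n \<omega>
  define m where "m = mean_at M X h"
  define A where "A = mean_at M X hdot \<theta>0 \<theta>0"
  \<comment> \<open>\<open>R\<close> is the remainder of assumption (iv), where the law varies;
    \<open>S\<close> is that of the expansion in the second argument, where the law stays at the
    estimate.\<close>
  define R where "R n \<omega> = inverse (c n) * (m (\<theta>hat n \<omega>) \<theta>0 - m \<theta>0 \<theta>0) - C \<bullet> U n \<omega>" for n \<omega>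
  define S where "S n \<omega> = inverse (c n) *
      (m (\<theta>hat n \<omega>) (\<theta>hat n \<omega>) - m (\<theta>hat n \<omega>) \<theta>0 - A \<bullet> (\<theta>hat n \<omega> - \<theta>0))" for n \<omega>
  have c_pos: "0 < c n" for n
    unfolding c_def max_entry_def using iii_pos by (subst Max_gr_iff) auto
  have UZ: "conv_in_distr M U N Zstar"
    using iii_Zstar unfolding U_def c_def .
  have [measurable]: "U n \<in> borel_measurable M" for n
    using UZ by (auto simp: conv_in_distr_def)
  have [measurable]: "\<theta>hat n \<in> borel_measurable M" for n by fact
  have W_meas[measurable]: "W n \<in> borel_measurable M" for n
    unfolding W_def using assms(11) by measurable
  \<comment> \<open>Splitting the expectation of the difference requires integrability, hence an
    estimate in \<Theta>, which is guaranteed only on \<open>space M\<close>.\<close>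
  have R_eq: "R n \<omega> = inverse (c n) * (\<integral>\<omega>'. h (X (\<theta>hat n \<omega>) \<omega>') \<theta>0 - h (X \<theta>0 \<omega>') \<theta>0 \<partial>M)
      - C \<bullet> U n \<omega>" if "\<omega> \<in> space M" for n \<omega>
    unfolding R_def m_def mean_at_def using that assms(4,7,10) by simp
  have R: "is_op1 M R"
  proof -
    have "is_op1 M (\<lambda>n \<omega>. inverse (c n) *
        (\<integral>\<omega>'. h (X (\<theta>hat n \<omega>) \<omega>') \<theta>0 - h (X \<theta>0 \<omega>') \<theta>0 \<partial>M) - C \<bullet> U n \<omega>)"
      using iv unfolding U_def c_def by simp
    then show ?thesis
      unfolding is_op1_def by (simp add: R_eq cong: measurable_cong conj_cong)
  qed
  then have [measurable]: "R n \<in> borel_measurable M" for n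
    by (auto simp: is_op1_def)
  have decomp: "W n \<omega> - (A + C) \<bullet> U n \<omega> = S n \<omega> + R n \<omega>" for n \<omega>
    unfolding W_def S_def R_def U_def m_def expected_functional_def
    by (simp add: algebra_simps)
  \<comment> \<open>The term \<open>m (\<theta>hat n \<omega>) \<theta>0\<close> inside
    \<open>S\<close> has no measurability assumption of its own; solving the decomposition for
    \<open>S\<close> derives measurability from \<open>W\<close>, \<open>U\<close> and
    \<open>R\<close>.\<close>
  have S_eq: "S n = (\<lambda>\<omega>. W n \<omega> - (A + C) \<bullet> U n \<omega> - R n \<omega>)" for n
    using decomp[of n] by (auto simp: fun_eq_iff)
  have "is_op1 M S"
  proof (rule is_op1_little_o_tight[OF assms(1,2) UZ, where c = c])
    show "S n \<in> borel_measurable M" for n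
      unfolding S_eq by measurable
    show "c \<longlonglongrightarrow> 0" using iii_lim by (simp add: c_def[abs_def])
    fix \<epsilon> :: real assume "0 < \<epsilon>"
    obtain \<delta> where \<delta>: "0 < \<delta>" "\<And>t. norm (t - \<theta>0) < \<delta> \<Longrightarrow>
        \<bar>m t t - m t \<theta>0 - A \<bullet> (t - \<theta>0)\<bar> \<le> \<epsilon> * norm (t - \<theta>0)"
      using joint_gradient_expansion[of \<Theta> \<theta>0 m "mean_at M X hdot" \<epsilon>] assms(3,4) i ii_joint \<open>0 < \<epsilon>\<close>
      unfolding m_def A_def by blast
    \<comment> \<open>Since \<open>c n *\<^sub>R U n \<omega>\<close> is the unscaled error, this is
      the deterministic expansion at \<open>t = \<theta>hat n \<omega>\<close>, divided by
      \<open>c n\<close>.\<close>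
    have "\<bar>S n \<omega>\<bar> \<le> \<epsilon> * norm (U n \<omega>)" if "norm (c n *\<^sub>R U n \<omega>) < \<delta>" for n \<omega>
    proof -
      have "norm (\<theta>hat n \<omega> - \<theta>0) < \<delta>"
        using that c_pos[of n] by (simp add: U_def)
      from \<delta>(2)[OF this] have "\<bar>S n \<omega>\<bar> \<le> inverse (c n) * (\<epsilon> * norm (\<theta>hat n \<omega> - \<theta>0))"
        using c_pos[of n] unfolding S_def abs_mult by (intro mult_mono) auto
      also have "\<dots> = \<epsilon> * norm (U n \<omega>)"
        using c_pos[of n] by (simp add: U_def)
      finally show ?thesis .
    qed
    with \<delta>(1) show "\<exists>\<delta>>0. \<forall>n. \<forall>\<omega>\<in>space M.
        norm (c n *\<^sub>R U n \<omega>) < \<delta> \<longrightarrow> \<bar>S n \<omega>\<bar> \<le> \<epsilon> * norm (U n \<omega>)"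
      by blast
  qed
  then have "is_op1 M (\<lambda>n \<omega>. W n \<omega> - (A + C) \<bullet> U n \<omega>)"
    unfolding decomp using R by (rule is_op1_add[OF assms(1)])
  then have WU: "is_op1 M (\<lambda>n \<omega>. norm (W n \<omega> - (A + C) \<bullet> U n \<omega>))"
    unfolding is_op1_def by simp
  have "conv_in_distr M (\<lambda>n \<omega>. (A + C) \<bullet> U n \<omega>) N (\<lambda>\<omega>. (A + C) \<bullet> Zstar \<omega>)"
    by (rule conv_in_distr_continuous_map[OF UZ]) (intro continuous_intros)
  then have "conv_in_distr M W N (\<lambda>\<omega>. (A + C) \<bullet> Zstar \<omega>)"
    by (rule slutsky_add[OF assms(1,2) _ W_meas WU])
  then show ?thesis
    unfolding W_def A_def c_def .
qed

end
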